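(* Let $(X,d,\preceq)$ be a complete ordered $L_{\uparrow}$ metric space. Suppose that $T,S:X\to B(X)$ are two partially dominating mappings which satisfy the generalized $(\psi,\varphi)$-weak contractive condition $$\psi(\delta(Sx,Ty))\le \psi(M(x,y))-\varphi(M(x,y))\quad\text{for all }(x,y)\in X_{\preceq},$$ where $$M(x,y)=\max\left\{d(x,y),\ \delta(x,Sx),\ \delta(y,Ty),\ \tfrac12\big(D(x,Ty)+D(y,Sx)\big)\right\},$$ $\psi\in\Upsilon$, and $\varphi:\mathbb{R}_{\ge 0}\to\mathbb{R}_{\ge 0}$ satisfies, for every sequence $\{t_n\}\subset\mathbb{R}_{\ge 0}$: if $\varphi(t_n)\to 0$ as $n\to\infty$, then $t_n\to 0$ as $n\to\infty$. Then there exists a point $u\in X$ such that $\{u\}=Tu=Su$. Moreover, if the end points of $S$ and $T$ are comparable, then $S$ and $T$ have a unique common end point.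
   Context: $\mathbb{R}_{\ge 0}$ is the set of nonnegative reals. A complete ordered $L_{\uparrow}$ metric space $(X,d,\preceq)$ is a nonempty set $X$ with a complete metric $d$ and a partial order $\preceq$ such that whenever $x_n\to x$ in $(X,d)$ and $x_n\preceq x_{n+1}$ for each $n\ge 1$, one has $x_n\preceq x$ for each $n\ge 1$. Two points $x,y$ are comparable if $x\preceq y$ or $y\preceq x$; $X_{\preceq}=\{(x,y)\in X^2: x\preceq y\text{ or }y\preceq x\}$. $B(X)$ is the class of all nonempty bounded subsets of $X$. For $A,B\in B(X)$, $\delta(A,B)=\sup\{d(a,b):a\in A,\ b\in B\}$ and $D(A,B)=\inf\{d(a,b):a\in A,\ b\in B\}$; a singleton $\{a\}$ is written $a$ in these expressions. A mapping $T:X\to B(X)$ is partially dominating if for every $y\in X$ there exists some $x\in Ty$ such that $y\preceq x$. A point $x$ is an end point of $T$ if $Tx=\{x\}$; a common end point of $S$ and $T$ is a point $x$ with $Sx=Tx=\{x\}$. "The end points of $S$ and $T$ are comparable" means that any two points of $X$, each of which is an end point of $S$ or of $T$, are comparable. $\Upsilon$ is the collection of all non-decreasing functions $\psi:\mathbb{R}_{\ge 0}\to\mathbb{R}_{\ge 0}$ such that for every two sequences $\{a_n\},\{b_n\}$ in $\mathbb{R}_{\ge 0}$ with $\lim_{n\to\infty}a_n=\lim_{n\to\infty}b_n$ one has $\lim_{n\to\infty}\psi(a_n)=\lim_{n\to\infty}\psi(b_n)$ (equality of limits includes that the limits exist as real numbers). *)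

theory Defs
  imports "HOL-Analysis.Analysis"
begin

text \<open>
  The space is a carrier set \<open>X\<close> with a metric \<open>d\<close> on it; the partial order is a relation
  \<open>r \<subseteq> X \<times> X\<close>, with \<open>(x, y) \<in> r\<close> standing for \<open>x \<preceq> y\<close>.
\<close>

locale complete_ordered_Lup_metric_space = Metric_space X d
  for X :: "'a set" and d :: "'a \<Rightarrow> 'a \<Rightarrow> real" +
  fixes r :: "('a \<times> 'a) set"
  assumes nonempty: "X \<noteq> {}"
    and complete: "mcomplete"
    and partial_order: "partial_order_on X r"
    and Lup: "\<And>\<sigma> x. range \<sigma> \<subseteq> X \<Longrightarrow> limitin mtopology \<sigma> x sequentially
                \<Longrightarrow> (\<And>n. (\<sigma> n, \<sigma> (Suc n)) \<in> r) \<Longrightarrow> (\<And>n. (\<sigma> n, x) \<in> r)"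

definition comparable :: "('a \<times> 'a) set \<Rightarrow> 'a \<Rightarrow> 'a \<Rightarrow> bool" where
  "comparable r x y \<longleftrightarrow> (x, y) \<in> r \<or> (y, x) \<in> r"

definition comparable_pairs :: "'a set \<Rightarrow> ('a \<times> 'a) set \<Rightarrow> ('a \<times> 'a) set" where
  "comparable_pairs X r = {(x, y) \<in> X \<times> X. comparable r x y}"

text \<open>\<open>mbounded A\<close> includes \<open>A \<subseteq> X\<close>.\<close>

definition bounded_subsets :: "'a set \<Rightarrow> ('a \<Rightarrow> 'a \<Rightarrow> real) \<Rightarrow> 'a set set" where
  "bounded_subsets X d = {A. A \<noteq> {} \<and> Metric_space.mbounded X d A}"

definition delta :: "('a \<Rightarrow> 'a \<Rightarrow> real) \<Rightarrow> 'a set \<Rightarrow> 'a set \<Rightarrow> real" where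
  "delta d A B = Sup {d a b | a b. a \<in> A \<and> b \<in> B}"

definition Dinf :: "('a \<Rightarrow> 'a \<Rightarrow> real) \<Rightarrow> 'a set \<Rightarrow> 'a set \<Rightarrow> real" where
  "Dinf d A B = Inf {d a b | a b. a \<in> A \<and> b \<in> B}"

definition partially_dominating :: "'a set \<Rightarrow> ('a \<times> 'a) set \<Rightarrow> ('a \<Rightarrow> 'a set) \<Rightarrow> bool" where
  "partially_dominating X r T \<longleftrightarrow> (\<forall>y\<in>X. \<exists>x\<in>T y. (y, x) \<in> r)"

definition end_point :: "'a set \<Rightarrow> ('a \<Rightarrow> 'a set) \<Rightarrow> 'a \<Rightarrow> bool" where
  "end_point X T x \<longleftrightarrow> x \<in> X \<and> T x = {x}"

definition end_points_comparable ::
    "'a set \<Rightarrow> ('a \<times> 'a) set \<Rightarrow> ('a \<Rightarrow> 'a set) \<Rightarrow> ('a \<Rightarrow> 'a set) \<Rightarrow> bool" where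
  "end_points_comparable X r S T \<longleftrightarrow>
     (\<forall>x y. (end_point X S x \<or> end_point X T x) \<and> (end_point X S y \<or> end_point X T y)
        \<longrightarrow> comparable r x y)"

text \<open>
  Functions on the nonnegative reals are functions \<open>real \<Rightarrow> real\<close> restricted to \<open>{0..}\<close>; their
  values at negative arguments are irrelevant.
\<close>

definition Upsilon :: "(real \<Rightarrow> real) set" where
  "Upsilon = {\<psi>. \<psi> \<in> {0..} \<rightarrow> {0..} \<and> mono_on {0..} \<psi> \<and>
     (\<forall>a b :: nat \<Rightarrow> real. (\<forall>n. 0 \<le> a n) \<longrightarrow> (\<forall>n. 0 \<le> b n) \<longrightarrow>
        (\<exists>l. a \<longlonglongrightarrow> l \<and> b \<longlonglongrightarrow> l) \<longrightarrow>
        (\<exists>m. (\<lambda>n. \<psi> (a n)) \<longlonglongrightarrow> m \<and> (\<lambda>n. \<psi> (b n)) \<longlonglongrightarrow> m))}"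

definition Mxy :: "('a \<Rightarrow> 'a \<Rightarrow> real) \<Rightarrow> ('a \<Rightarrow> 'a set) \<Rightarrow> ('a \<Rightarrow> 'a set) \<Rightarrow> 'a \<Rightarrow> 'a \<Rightarrow> real" where
  "Mxy d S T x y = Max {d x y, delta d {x} (S x), delta d {y} (T y),
                        1 / 2 * (Dinf d {x} (T y) + Dinf d {y} (S x))}"

definition gen_weak_contractive ::
    "'a set \<Rightarrow> ('a \<Rightarrow> 'a \<Rightarrow> real) \<Rightarrow> ('a \<times> 'a) set \<Rightarrow> (real \<Rightarrow> real) \<Rightarrow> (real \<Rightarrow> real)
      \<Rightarrow> ('a \<Rightarrow> 'a set) \<Rightarrow> ('a \<Rightarrow> 'a set) \<Rightarrow> bool" where
  "gen_weak_contractive X d r \<psi> \<phi> S T \<longleftrightarrow>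
     (\<forall>(x, y) \<in> comparable_pairs X r.
        \<psi> (delta d (S x) (T y)) \<le> \<psi> (Mxy d S T x y) - \<phi> (Mxy d S T x y))"

end

theory Submission
  imports Defs
begin

text \<open>
  Apart from the monotonicity of \<open>\<psi>\<close>, the conditions on \<open>\<psi>\<close> and \<open>\<phi>\<close> enter through one
  principle (lemma \<open>common_limit_zero\<close>): \<open>\<psi>\<close> is continuous, so if
  \<open>\<psi> (s n) \<le> \<psi> (t n) - \<phi> (t n)\<close> and \<open>s\<close> and \<open>t\<close> have the same limit, then
  \<open>\<phi> (t n) \<le> \<psi> (t n) - \<psi> (s n)\<close> tends to zero, and hence so does \<open>t\<close>.
  Its consequences are a constant version (\<open>no_increase\<close>) and a Meir--Keeler condition
  (\<open>Meir_Keeler\<close>).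

  Since both maps are partially dominating, from any point one can build an increasing orbit \<open>x\<close>
  that moves by \<open>S\<close> and by \<open>T\<close> in turn.  Let \<open>e n\<close> be the distance \<open>\<delta>\<close> of \<open>x n\<close> to the set that
  \<open>x (n + 1)\<close> is taken from.  At consecutive orbit points the quantity \<open>M\<close> of the contractive
  condition is at most \<open>max (e n) (e (n + 1))\<close>, while \<open>e (n + 1)\<close> is at most the left-hand \<open>\<delta>\<close>; so
  \<open>e\<close> decreases, and the principle applied to \<open>e\<close> and its shift gives \<open>e \<longlonglongrightarrow> 0\<close>.

  For two orbit points whose indices have different parity, \<open>M\<close> exceeds their distance by at most
  the sum of the errors \<open>e\<close>, so once these are small the Meir--Keeler condition shows that a
  distance below \<open>\<epsilon> + \<eta>\<close> drops below \<open>\<epsilon>\<close> when both indices advance by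
  one; an induction on the gap between the indices makes the orbit Cauchy without any choice of subsequences.

  The limit \<open>u\<close> lies above the whole orbit.  Comparing \<open>u\<close> with the points at which \<open>T\<close> acts, both
  sides of the contractive inequality are governed by \<open>\<delta> u (S u)\<close> in the limit, which is
  therefore zero; comparing \<open>u\<close> with itself then yields \<open>T u = {u}\<close>.  For two comparable common end
  points both \<open>\<delta>\<close> and \<open>M\<close> equal their distance, which must vanish.
\<close>

section \<open>Weak contractive inequalities between real numbers\<close>

locale weak_contractive_control =
  fixes \<psi> \<phi> :: "real \<Rightarrow> real"
  assumes psi_Upsilon: "\<psi> \<in> Upsilon"
    and phi_nonneg: "\<phi> \<in> {0..} \<rightarrow> {0..}"
    and phi_null: "\<And>t :: nat \<Rightarrow> real.
      (\<And>n. 0 \<le> t n) \<Longrightarrow> (\<lambda>n. \<phi> (t n)) \<longlonglongrightarrow> 0 \<Longrightarrow> t \<longlonglongrightarrow> 0"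
begin

lemma psi_mono: "0 \<le> s \<Longrightarrow> s \<le> t \<Longrightarrow> \<psi> s \<le> \<psi> t"
  using psi_Upsilon by (auto simp: Upsilon_def mono_on_def)

text \<open>
  Comparing an arbitrary sequence with the constant sequence at its limit shows that the condition
  in \<open>Upsilon\<close> on pairs of sequences is continuity.
\<close>

lemma psi_tendsto:
  assumes "\<And>n. 0 \<le> a n" and "a \<longlonglongrightarrow> l"
  shows "(\<lambda>n. \<psi> (a n)) \<longlonglongrightarrow> \<psi> l"
proof -
  have "0 \<le> l"
    using LIMSEQ_le_const[OF assms(2)] assms(1) by blast
  moreover have "\<forall>a b :: nat \<Rightarrow> real. (\<forall>n. 0 \<le> a n) \<longrightarrow> (\<forall>n. 0 \<le> b n) \<longrightarrow>
      (\<exists>l. a \<longlonglongrightarrow> l \<and> b \<longlonglongrightarrow> l) \<longrightarrow>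
      (\<exists>m. (\<lambda>n. \<psi> (a n)) \<longlonglongrightarrow> m \<and> (\<lambda>n. \<psi> (b n)) \<longlonglongrightarrow> m)"
    using psi_Upsilon by (simp add: Upsilon_def)
  ultimately have "\<exists>m. (\<lambda>n. \<psi> (a n)) \<longlonglongrightarrow> m \<and> (\<lambda>n::nat. \<psi> l) \<longlonglongrightarrow> m"
    using assms tendsto_const[of l sequentially]
    by (elim allE[of _ a] allE[of _ "\<lambda>_. l"]) blast
  then show ?thesis
    using LIMSEQ_unique[OF tendsto_const] by blast
qed

lemma common_limit_zero:
  assumes s0: "\<And>n. 0 \<le> s n" and t0: "\<And>n. 0 \<le> t n"
    and s: "s \<longlonglongrightarrow> l" and t: "t \<longlonglongrightarrow> l"
    and le: "\<And>n. \<psi> (s n) \<le> \<psi> (t n) - \<phi> (t n)"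
  shows "l = 0"
proof -
  have "(\<lambda>n. \<psi> (t n) - \<psi> (s n)) \<longlonglongrightarrow> \<psi> l - \<psi> l"
    by (intro tendsto_diff psi_tendsto s t s0 t0)
  then have "(\<lambda>n. \<psi> (t n) - \<psi> (s n)) \<longlonglongrightarrow> 0"
    by simp
  then have "(\<lambda>n. \<phi> (t n)) \<longlonglongrightarrow> 0"
  proof (rule tendsto_sandwich[OF _ _ tendsto_const, rotated 2])
    show "\<forall>\<^sub>F n in sequentially. 0 \<le> \<phi> (t n)"
      using phi_nonneg t0 by (intro always_eventually) (auto simp: Pi_iff)
    show "\<forall>\<^sub>F n in sequentially. \<phi> (t n) \<le> \<psi> (t n) - \<psi> (s n)"
      using le by (simp add: algebra_simps)
  qed
  then have "t \<longlonglongrightarrow> 0"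
    using phi_null t0 by blast
  then show ?thesis
    using t LIMSEQ_unique by blast
qed

lemma no_increase:
  assumes "0 \<le> t" "t \<le> s" "\<psi> s \<le> \<psi> t - \<phi> t"
  shows "t = 0"
proof (rule common_limit_zero)
  show "\<psi> t \<le> \<psi> t - \<phi> t"
    using assms psi_mono[of t s] by linarith
qed (use assms in auto)

text \<open>
  Positivity of \<open>t\<close> cannot be dropped: if \<open>\<psi>\<close> is constant and \<open>\<phi> 0 = 0\<close>, the inequality between
  \<open>s\<close> and \<open>t = 0\<close> says nothing about \<open>s\<close>.
\<close>

lemma Meir_Keeler:
  assumes "0 < \<epsilon>"
  shows "\<exists>\<eta>>0. \<forall>s t. 0 < t \<longrightarrow> t < \<epsilon> + \<eta> \<longrightarrow> \<psi> s \<le> \<psi> t - \<phi> t \<longrightarrow> s < \<epsilon>"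
proof (rule ccontr)
  assume neg: "\<not> ?thesis"
  have "\<exists>t. \<epsilon> \<le> t \<and> t < \<epsilon> + inverse (real (Suc n)) \<and> \<psi> \<epsilon> \<le> \<psi> t - \<phi> t" for n
  proof -
    have "0 < inverse (real (Suc n))"
      by simp
    then obtain s t where st: "0 < t" "t < \<epsilon> + inverse (real (Suc n))"
        "\<psi> s \<le> \<psi> t - \<phi> t" "\<epsilon> \<le> s"
      using neg[unfolded not_ex, THEN spec, of "inverse (real (Suc n))"]
      by (auto simp: not_less)
    have le: "\<psi> \<epsilon> \<le> \<psi> t - \<phi> t"
      using psi_mono[of \<epsilon> s] st assms by linarith
    moreover have "\<epsilon> \<le> t"
      using no_increase[of t \<epsilon>] le st(1) by force
    ultimately show ?thesis
      using st by blast
  qed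
  then obtain t where t: "\<And>n. \<epsilon> \<le> t n" "\<And>n. t n < \<epsilon> + inverse (real (Suc n))"
      "\<And>n. \<psi> \<epsilon> \<le> \<psi> (t n) - \<phi> (t n)"
    by metis
  have "t \<longlonglongrightarrow> \<epsilon>"
  proof (rule tendsto_sandwich[OF _ _ tendsto_const])
    show "(\<lambda>n. \<epsilon> + inverse (real (Suc n))) \<longlonglongrightarrow> \<epsilon>"
      using tendsto_add[OF tendsto_const LIMSEQ_inverse_real_of_nat, of \<epsilon>] by simp
    show "\<forall>\<^sub>F n in sequentially. t n \<le> \<epsilon> + inverse (real (Suc n))"
      using t(2) by (intro always_eventually allI less_imp_le)
  qed (use t(1) in simp)
  moreover have "0 \<le> t n" for n
    using t(1)[of n] assms by linarith
  ultimately have "\<epsilon> = 0"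
    using common_limit_zero[of "\<lambda>_. \<epsilon>" t \<epsilon>] t(3) assms by auto
  then show False
    using assms by simp
qed

end

section \<open>Largest and smallest distances between bounded sets\<close>

lemma (in Metric_space) delta_commute: "delta d A B = delta d B A"
proof -
  have "{d a b | a b. a \<in> A \<and> b \<in> B} = {d a b | a b. a \<in> B \<and> b \<in> A}"
    using commute by blast
  then show ?thesis
    by (simp add: delta_def)
qed

lemma (in Metric_space) dist_le_delta:
  assumes A: "mbounded A" and B: "mbounded B" and "a \<in> A" "b \<in> B"
  shows "d a b \<le> delta d A B"
  unfolding delta_def
proof (rule cSup_upper)
  obtain K where "\<And>x y. x \<in> A \<union> B \<Longrightarrow> y \<in> A \<union> B \<Longrightarrow> d x y \<le> K"
    using A B mbounded_Un[of A B] unfolding mbounded_alt[of "A \<union> B"] by blast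
  then show "bdd_above {d a b | a b. a \<in> A \<and> b \<in> B}"
    by (intro bdd_aboveI[of _ K]) blast
qed (use assms in blast)

lemma (in Metric_space) dist_le_delta_singleton:
  "u \<in> M \<Longrightarrow> mbounded A \<Longrightarrow> a \<in> A \<Longrightarrow> d u a \<le> delta d {u} A"
  by (rule dist_le_delta) (auto simp: mbounded_insert)

lemma delta_le:
  assumes "A \<noteq> {}" "B \<noteq> {}" "\<And>a b. a \<in> A \<Longrightarrow> b \<in> B \<Longrightarrow> d a b \<le> c"
  shows "delta d A B \<le> c"
  unfolding delta_def by (rule cSup_least) (use assms in auto)

lemma delta_singletons: "delta d {a} {b} = d a b"
  by (simp add: delta_def)

lemma (in Metric_space) Dinf_le_dist:
  assumes "a \<in> A" "b \<in> B"
  shows "Dinf d A B \<le> d a b"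
  unfolding Dinf_def
proof (rule cInf_lower)
  show "bdd_below {d a b | a b. a \<in> A \<and> b \<in> B}"
    by (rule bdd_belowI[of _ 0]) auto
qed (use assms in blast)

lemma (in Metric_space) eq_singleton_if_delta_nonpos:
  assumes "u \<in> M" "mbounded A" "A \<noteq> {}" "delta d {u} A \<le> 0"
  shows "A = {u}"
proof -
  have "a = u" if "a \<in> A" for a
  proof -
    have "d u a \<le> 0"
      using dist_le_delta_singleton[of u A a] assms that by auto
    moreover have "a \<in> M"
      using that assms mbounded_subset_mspace by blast
    ultimately show ?thesis
      using assms(1) zero[of u a] nonneg[of u a] by auto
  qed
  then show ?thesis
    using assms(3) by blast
qed

lemma Mxy_ge:
  "d x y \<le> Mxy d S T x y"
  "delta d {x} (S x) \<le> Mxy d S T x y"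
  "delta d {y} (T y) \<le> Mxy d S T x y"
  by (auto simp: Mxy_def)

text \<open>
  Distances to individual points \<open>a\<close> and \<open>b\<close> bound the two infima in \<open>M\<close>; \<open>a\<close> and \<open>b\<close> will be the
  next orbit points.
\<close>

lemma (in Metric_space) Mxy_le:
  assumes "d x y \<le> c" "delta d {x} (S x) \<le> c" "delta d {y} (T y) \<le> c"
    and "a \<in> S x" "b \<in> T y" "d x b + d y a \<le> 2 * c"
  shows "Mxy d S T x y \<le> c"
  using assms Dinf_le_dist[of x "{x}" b "T y"] Dinf_le_dist[of y "{y}" a "S x"]
  by (auto simp: Mxy_def)

section \<open>Pairs of weakly contractive maps\<close>

locale weak_contractive_pair =
  complete_ordered_Lup_metric_space X d r + weak_contractive_control \<psi> \<phi>
  for X :: "'a set" and d r \<psi> \<phi> +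
  fixes S T :: "'a \<Rightarrow> 'a set"
  assumes T_bounded: "T \<in> X \<rightarrow> bounded_subsets X d"
    and S_bounded: "S \<in> X \<rightarrow> bounded_subsets X d"
    and T_dominating: "partially_dominating X r T"
    and S_dominating: "partially_dominating X r S"
    and contractive: "gen_weak_contractive X d r \<psi> \<phi> S T"
begin

lemma values_bounded:
  assumes "x \<in> X"
  shows "mbounded (S x)" "mbounded (T x)" "S x \<noteq> {}" "T x \<noteq> {}"
  using assms S_bounded T_bounded by (auto simp: bounded_subsets_def)

lemma contraction:
  assumes "x \<in> X" "y \<in> X" "(x, y) \<in> r \<or> (y, x) \<in> r"
  shows "\<psi> (delta d (S x) (T y)) \<le> \<psi> (Mxy d S T x y) - \<phi> (Mxy d S T x y)"
  using assms contractive
  by (auto simp: gen_weak_contractive_def comparable_pairs_def comparable_def)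

lemma contraction_swapped:
  assumes "x \<in> X" "y \<in> X" "(x, y) \<in> r \<or> (y, x) \<in> r"
  shows "\<psi> (delta d (T x) (S y)) \<le> \<psi> (Mxy d T S x y) - \<phi> (Mxy d T S x y)"
proof -
  \<comment> \<open>\<open>M\<close> is invariant under exchanging the points together with the maps.\<close>
  have "Mxy d T S x y = Mxy d S T y x"
    by (simp add: Mxy_def commute add.commute insert_commute)
  then show ?thesis
    using contraction[of y x] assms by (auto simp: delta_commute)
qed

lemma order_refl: "x \<in> X \<Longrightarrow> (x, x) \<in> r"
  using partial_order by (auto simp: partial_order_on_def preorder_on_def refl_on_def)

lemma order_trans: "(x, y) \<in> r \<Longrightarrow> (y, z) \<in> r \<Longrightarrow> (x, z) \<in> r"
  using partial_order by (auto simp: partial_order_on_def preorder_on_def dest: transD)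

lemma comparable_common_end_points_eq:
  assumes "end_point X S u" "end_point X T u" "end_point X S v" "end_point X T v"
    and "comparable r u v"
  shows "u = v"
proof -
  have uv: "u \<in> X" "v \<in> X" "S u = {u}" "T v = {v}"
    using assms by (auto simp: end_point_def)
  have "Mxy d S T u v \<le> d u v"
    using uv by (intro Mxy_le[where a = u and b = v]) (auto simp: delta_singletons commute)
  then have "Mxy d S T u v = d u v"
    using Mxy_ge(1) by (rule antisym)
  then have "d u v = 0"
    using contraction[of u v] no_increase[of "d u v" "d u v"] uv assms(5)
    by (auto simp: comparable_def delta_singletons)
  then show ?thesis
    using uv by simp
qed

definition alternating :: "nat \<Rightarrow> 'a \<Rightarrow> 'a set" where
  "alternating n = (if even n then S else T)"

lemma ex_increasing_orbit:
  "\<exists>x. x 0 \<in> X \<and> (\<forall>n. x (Suc n) \<in> alternating n (x n) \<and> (x n, x (Suc n)) \<in> r)"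
proof -
  have "\<exists>z. y \<in> X \<longrightarrow> z \<in> alternating n y \<and> (y, z) \<in> r" for n y
    using S_dominating T_dominating by (auto simp: alternating_def partially_dominating_def)
  then have "\<forall>n y. \<exists>z. y \<in> X \<longrightarrow> z \<in> alternating n y \<and> (y, z) \<in> r"
    by blast
  then obtain f where f: "\<And>n y. y \<in> X \<Longrightarrow> f n y \<in> alternating n y \<and> (y, f n y) \<in> r"
    unfolding choice_iff by blast
  obtain x0 where x0: "x0 \<in> X"
    using nonempty by blast
  define x where "x = rec_nat x0 f"
  have "x n \<in> X" for n
  proof (induction n)
    case (Suc n)
    then have "x (Suc n) \<in> alternating n (x n)"
      using f by (simp add: x_def)
    then show ?case
      using values_bounded[OF Suc] mbounded_subset_mspace
      by (auto simp: alternating_def split: if_splits)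
  qed (use x0 in \<open>simp add: x_def\<close>)
  then show ?thesis
    using f x0 by (intro exI[of _ x]) (auto simp: x_def)
qed

end

section \<open>Increasing alternating orbits\<close>

locale increasing_orbit = weak_contractive_pair X d r \<psi> \<phi> S T
  for X :: "'a set" and d r \<psi> \<phi> S T +
  fixes x :: "nat \<Rightarrow> 'a"
  assumes orbit_start: "x 0 \<in> X"
    and orbit_step: "x (Suc n) \<in> alternating n (x n)"
    and orbit_increasing: "(x n, x (Suc n)) \<in> r"
begin

text \<open>
  Up to the \<open>D\<close> term and the distance of the two points, \<open>M\<close> at orbit points consists of these
  numbers; they also bound the steps of the orbit.
\<close>

definition e :: "nat \<Rightarrow> real" where
  "e n = delta d {x n} (alternating n (x n))"

lemma orbit_in: "x n \<in> X"
proof (induction n)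
  case (Suc n)
  then show ?case
    using orbit_step[of n] values_bounded[OF Suc] mbounded_subset_mspace
    by (auto simp: alternating_def split: if_splits)
qed (rule orbit_start)

lemma alternating_bounded: "mbounded (alternating n (x n))" "alternating n (x n) \<noteq> {}"
  using values_bounded[OF orbit_in] by (auto simp: alternating_def)

lemma orbit_le: "i \<le> j \<Longrightarrow> (x i, x j) \<in> r"
  by (induction j rule: dec_induct)
    (use orbit_in order_refl orbit_increasing order_trans in blast)+

lemma dist_step_le: "d (x n) (x (Suc n)) \<le> e n"
  unfolding e_def
  by (rule dist_le_delta_singleton) (rule orbit_in alternating_bounded orbit_step)+

lemma orbit_triangle: "d (x i) (x k) \<le> d (x i) (x j) + d (x j) (x k)"
  using triangle orbit_in by blast

lemma e_nonneg: "0 \<le> e n"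
  using dist_step_le[of n] nonneg[of "x n" "x (Suc n)"] by linarith

text \<open>
  The contractive condition needs one point for each of the two maps; different parity of the
  indices provides this.
\<close>

lemma orbit_contraction:
  assumes "even i \<noteq> even j"
  shows "\<psi> (delta d (alternating i (x i)) (alternating j (x j)))
    \<le> \<psi> (Mxy d (alternating i) (alternating j) (x i) (x j))
      - \<phi> (Mxy d (alternating i) (alternating j) (x i) (x j))"
proof -
  have "(x i, x j) \<in> r \<or> (x j, x i) \<in> r"
    using orbit_le[of i j] orbit_le[of j i] by linarith
  then show ?thesis
    using assms contraction contraction_swapped orbit_in by (auto simp: alternating_def)
qed

lemma Mxy_nonneg: "0 \<le> Mxy d F G y z"
  using Mxy_ge(1)[of d y z F G] nonneg[of y z] by linarith

text \<open>
  For consecutive points one half of the \<open>D\<close> term vanishes, because \<open>x (n + 1)\<close> lies in the set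
  belonging to \<open>x n\<close>; the other half is controlled by the triangle inequality.  So \<open>M\<close> is exactly the
  larger of the two errors.
\<close>

lemma consecutive_contraction:
  "\<psi> (e (Suc n)) \<le> \<psi> (max (e n) (e (Suc n))) - \<phi> (max (e n) (e (Suc n)))"
proof -
  let ?M = "Mxy d (alternating n) (alternating (Suc n)) (x n) (x (Suc n))"
  have "?M \<le> max (e n) (e (Suc n))"
  proof (rule Mxy_le[where a = "x (Suc n)" and b = "x (Suc (Suc n))"])
    have "d (x n) (x (Suc (Suc n))) \<le> e n + e (Suc n)"
      using orbit_triangle[of n "Suc (Suc n)" "Suc n"]
        dist_step_le[of n] dist_step_le[of "Suc n"] by linarith
    then show "d (x n) (x (Suc (Suc n))) + d (x (Suc n)) (x (Suc n)) \<le> 2 * max (e n) (e (Suc n))"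
      using orbit_in by simp
    show "d (x n) (x (Suc n)) \<le> max (e n) (e (Suc n))"
      using dist_step_le[of n] by simp
  qed (auto simp: e_def orbit_step)
  moreover have "max (e n) (e (Suc n)) \<le> ?M"
    using Mxy_ge(2,3)[where d = d] by (auto simp: e_def)
  ultimately have M: "?M = max (e n) (e (Suc n))"
    by simp
  have "e (Suc n) \<le> delta d (alternating n (x n)) (alternating (Suc n) (x (Suc n)))"
    unfolding e_def[of "Suc n"]
    using alternating_bounded orbit_step by (intro delta_le) (auto intro: dist_le_delta)
  then show ?thesis
    using orbit_contraction[of n "Suc n"] psi_mono[OF e_nonneg] M by fastforce
qed

lemma e_decreasing: "e (Suc n) \<le> e n"
proof (rule ccontr)
  assume "\<not> e (Suc n) \<le> e n"
  then have "e (Suc n) = 0"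
    using consecutive_contraction[of n] no_increase[of "e (Suc n)" "e (Suc n)"] e_nonneg
    by (simp add: max_def)
  then show False
    using \<open>\<not> e (Suc n) \<le> e n\<close> e_nonneg[of n] by simp
qed

lemma e_tendsto_0: "e \<longlonglongrightarrow> 0"
proof -
  obtain l where l: "e \<longlonglongrightarrow> l"
    using decseq_convergent[of e 0] e_decreasing e_nonneg by (metis decseq_Suc_iff)
  have "\<psi> (e (Suc n)) \<le> \<psi> (e n) - \<phi> (e n)" for n
    using consecutive_contraction[of n] e_decreasing[of n] by (simp add: max_def split: if_splits)
  then have "l = 0"
    using common_limit_zero[of "\<lambda>n. e (Suc n)" e l] l e_nonneg LIMSEQ_Suc by blast
  then show ?thesis
    using l by simp
qed

text \<open>
  \<open>M\<close> is within the two errors of the distance, so a threshold of \<open>\<eta> / 3\<close> for each of the three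
  contributions keeps it below \<open>\<epsilon> + \<eta>\<close>.
\<close>

lemma orbit_Meir_Keeler:
  assumes "0 < \<epsilon>"
  shows "\<exists>\<eta>>0. \<forall>i j. even i \<noteq> even j \<longrightarrow> e i < \<eta> \<longrightarrow> e j < \<eta> \<longrightarrow> d (x i) (x j) < \<epsilon> + \<eta>
    \<longrightarrow> d (x (Suc i)) (x (Suc j)) < \<epsilon>"
proof -
  obtain \<eta> where \<eta>: "0 < \<eta>"
    and MK: "\<And>s t. 0 < t \<Longrightarrow> t < \<epsilon> + \<eta> \<Longrightarrow> \<psi> s \<le> \<psi> t - \<phi> t \<Longrightarrow> s < \<epsilon>"
    using Meir_Keeler[OF assms] by blast
  have "d (x (Suc i)) (x (Suc j)) < \<epsilon>"
    if ij: "even i \<noteq> even j" "e i < \<eta> / 3" "e j < \<eta> / 3" "d (x i) (x j) < \<epsilon> + \<eta> / 3" for i j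
  proof -
    let ?M = "Mxy d (alternating i) (alternating j) (x i) (x j)"
    have tri: "d (x i) (x (Suc j)) \<le> d (x i) (x j) + e j"
      "d (x j) (x (Suc i)) \<le> d (x i) (x j) + e i"
      "d (x (Suc i)) (x (Suc j)) \<le> e i + d (x i) (x (Suc j))"
      using orbit_triangle[of i "Suc j" j] orbit_triangle[of j "Suc i" i]
        orbit_triangle[of "Suc i" "Suc j" i]
        dist_step_le[of i] dist_step_le[of j] commute[of "x j" "x i"]
        commute[of "x (Suc i)" "x i"] by linarith+
    have "?M \<le> d (x i) (x j) + (e i + e j)"
    proof (rule Mxy_le[where a = "x (Suc i)" and b = "x (Suc j)"])
      show "d (x i) (x (Suc j)) + d (x j) (x (Suc i)) \<le> 2 * (d (x i) (x j) + (e i + e j))"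
        using tri(1,2) e_nonneg[of i] e_nonneg[of j] unfolding distrib_left by linarith
    qed (use e_nonneg orbit_step nonneg[of "x i" "x j"] in
        \<open>auto simp flip: e_def simp: add_increasing add_increasing2\<close>)
    then have M: "?M < \<epsilon> + \<eta>"
      using ij by linarith
    show ?thesis
    proof (cases "0 < ?M")
      case True
      then have "delta d (alternating i (x i)) (alternating j (x j)) < \<epsilon>"
        using MK M orbit_contraction[OF ij(1)] by blast
      moreover have "d (x (Suc i)) (x (Suc j)) \<le> delta d (alternating i (x i)) (alternating j (x j))"
        using alternating_bounded orbit_step by (intro dist_le_delta)
      ultimately show ?thesis
        by linarith
    next
      \<comment> \<open>\<open>M = 0\<close>, where the Meir--Keeler condition is silent, means that the orbit stands still.\<close>
      case False
      then have "d (x i) (x j) \<le> 0" "e i \<le> 0" "e j \<le> 0"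
        using Mxy_ge[where d = d and x = "x i" and y = "x j"
            and S = "alternating i" and T = "alternating j"]
        by (auto simp: e_def)
      then show ?thesis
        using tri(1,3) assms by linarith
    qed
  qed
  then show ?thesis
    using \<eta> by (intro exI[of _ "\<eta> / 3"]) auto
qed

text \<open>
  Advancing both ends of a gap by one brings the distance below \<open>\<epsilon>\<close>, and restoring the left end
  while extending the right one costs at most two small steps; so the bound for an odd gap survives
  an increase of the gap by two.  An even gap is an odd gap and one further step.
\<close>

lemma orbit_Cauchy: "MCauchy x"
proof -
  have "\<exists>N. \<forall>i k. N \<le> i \<longrightarrow> d (x i) (x (i + k)) < \<epsilon>" if "0 < \<epsilon>" for \<epsilon>
  proof -
    obtain \<eta> where \<eta>: "0 < \<eta>" and MK: "\<And>i j. even i \<noteq> even j \<Longrightarrow> e i < \<eta> \<Longrightarrow> e j < \<eta> \<Longrightarrow>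
        d (x i) (x j) < \<epsilon> / 2 + \<eta> \<Longrightarrow> d (x (Suc i)) (x (Suc j)) < \<epsilon> / 2"
      using orbit_Meir_Keeler[of "\<epsilon> / 2"] \<open>0 < \<epsilon>\<close> half_gt_zero by blast
    \<comment> \<open>Two steps of size \<open>c\<close> fit into \<open>\<eta>\<close>, as the induction needs; three fit into the other half
      of \<open>\<epsilon>\<close>: two from the bound for odd gaps and one to reach even gaps.\<close>
    define c where "c = min (\<eta> / 2) (\<epsilon> / 6)"
    have c: "0 < c" "2 * c \<le> \<eta>" "3 * c \<le> \<epsilon> / 2"
      using \<eta> that by (auto simp: c_def)
    obtain N where N: "\<And>n. N \<le> n \<Longrightarrow> e n < c"
      using order_tendstoD(2)[OF e_tendsto_0 c(1)] by (auto simp: eventually_sequentially)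
    have odd_gap: "d (x i) (x (i + Suc (2 * m))) < \<epsilon> / 2 + 2 * c" if "N \<le> i" for i m
    proof (induction m)
      case 0
      show ?case
        using dist_step_le[of i] N[OF that] \<open>0 < \<epsilon>\<close> c(1) by simp
    next
      case (Suc m)
      let ?j = "i + Suc (2 * m)"
      have "d (x (Suc i)) (x (Suc ?j)) < \<epsilon> / 2"
        using N[of i] N[of ?j] that c(1,2) Suc by (intro MK) auto
      then show ?case
        using orbit_triangle[of i "Suc (Suc ?j)" "Suc i"]
          orbit_triangle[of "Suc i" "Suc (Suc ?j)" "Suc ?j"]
          dist_step_le[of i] dist_step_le[of "Suc ?j"] N[of i] N[of "Suc ?j"] that by simp
    qed
    have "d (x i) (x (i + k)) < \<epsilon>" if "N \<le> i" for i k
    proof (cases "even k")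
      case True
      show ?thesis
      proof (cases k)
        case 0
        then show ?thesis
          using \<open>0 < \<epsilon>\<close> orbit_in by simp
      next
        case (Suc j)
        then have "odd j"
          using True by simp
        then obtain m where "j = 2 * m + 1"
          by (rule oddE)
        then have m: "k = Suc (Suc (2 * m))"
          using Suc by simp
        show ?thesis
          using odd_gap[OF that, of m] dist_step_le[of "i + Suc (2 * m)"]
            N[of "i + Suc (2 * m)"] that c(3)
            orbit_triangle[of i "Suc (i + Suc (2 * m))" "i + Suc (2 * m)"]
          by (simp add: m)
      qed
    next
      case False
      then obtain m where "k = 2 * m + 1"
        by (rule oddE)
      then show ?thesis
        using odd_gap[OF that, of m] c by simp
    qed
    then show ?thesis
      by blast
  qed
  then have gap: "\<And>\<epsilon>. 0 < \<epsilon> \<Longrightarrow> \<exists>N. \<forall>i k. N \<le> i \<longrightarrow> d (x i) (x (i + k)) < \<epsilon>"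
    by blast
  have "\<exists>N. \<forall>n n'. N \<le> n \<longrightarrow> N \<le> n' \<longrightarrow> d (x n) (x n') < \<epsilon>" if \<epsilon>: "0 < \<epsilon>" for \<epsilon>
  proof -
    obtain N where N: "\<And>i k. N \<le> i \<Longrightarrow> d (x i) (x (i + k)) < \<epsilon>"
      using gap[OF \<epsilon>] by blast
    have "d (x n) (x n') < \<epsilon>" if "N \<le> n" "N \<le> n'" for n n'
      using N[of n "n' - n"] N[of n' "n - n'"] that commute[of "x n" "x n'"]
      by (cases "n \<le> n'") auto
    then show ?thesis
      by blast
  qed
  then show ?thesis
    using orbit_in by (auto simp: MCauchy_def)
qed

text \<open>
  The contractive inequality at \<open>u\<close> and the points where \<open>T\<close> acts is passed to the limit: \<open>M\<close> tends
  to \<open>\<delta> u (S u)\<close>, and the left-hand \<open>\<delta>\<close> is at least \<open>\<delta> u (S u)\<close> up to the vanishing distance of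
  the next orbit point to \<open>u\<close>.  Once \<open>S u = {u}\<close>, the inequality at the pair \<open>(u, u)\<close> reads
  \<open>\<psi> \<delta> \<le> \<psi> \<delta> - \<phi> \<delta>\<close> for \<open>\<delta> = \<delta> u (T u)\<close>.
\<close>

lemma common_end_point: "\<exists>u\<in>X. S u = {u} \<and> T u = {u}"
proof -
  obtain u where u: "limitin mtopology x u sequentially"
    using complete orbit_Cauchy unfolding mcomplete_def by blast
  have uX: "u \<in> X" and dist0: "(\<lambda>n. d (x n) u) \<longlonglongrightarrow> 0"
    using u by (auto simp: limitin_metric_dist_null)
  have below: "(x n, u) \<in> r" for n
    using Lup[of x u] u orbit_in orbit_increasing by blast
  define L where "L = delta d {u} (S u)"
  have L_upper: "d u a \<le> L" if "a \<in> S u" for a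
    unfolding L_def by (rule dist_le_delta_singleton[OF uX values_bounded(1)[OF uX] that])
  obtain a where a: "a \<in> S u"
    using values_bounded[OF uX] by blast
  then have aX: "a \<in> X"
    using values_bounded(1)[OF uX] mbounded_subset_mspace by blast
  have L0: "0 \<le> L"
    using L_upper[OF a] nonneg[of u a] by linarith
  \<comment> \<open>\<open>T\<close> acts at the odd indices.\<close>
  define p where "p k = Suc (2 * k)" for k :: nat
  have p_alt: "alternating (p k) = T" for k
    by (simp add: alternating_def p_def)
  have p_mono: "strict_mono p" "strict_mono (\<lambda>k. Suc (p k))"
    by (auto simp: p_def strict_mono_def)
  have next_T: "x (Suc (p k)) \<in> T (x (p k))" for k
    using orbit_step[of "p k"] p_alt by simp
  define t where "t k = Mxy d S T u (x (p k))" for k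
  \<comment> \<open>\<open>s k\<close> is a lower bound of the left-hand \<open>\<delta>\<close>; it is cut off at \<open>0\<close> to stay in the domain
    of \<open>\<psi>\<close>.\<close>
  define s where "s k = max 0 (L - d (x (Suc (p k))) u)" for k
  have dist_p: "(\<lambda>k. d (x (p k)) u) \<longlonglongrightarrow> 0" "(\<lambda>k. d (x (Suc (p k))) u) \<longlonglongrightarrow> 0"
    "(\<lambda>k. e (p k)) \<longlonglongrightarrow> 0"
    using LIMSEQ_subseq_LIMSEQ[OF dist0 p_mono(1)] LIMSEQ_subseq_LIMSEQ[OF dist0 p_mono(2)]
      LIMSEQ_subseq_LIMSEQ[OF e_tendsto_0 p_mono(1)] by (simp_all add: o_def)
  have "t \<longlonglongrightarrow> L"
  proof (rule tendsto_sandwich[OF _ _ tendsto_const])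
    show "\<forall>\<^sub>F k in sequentially. L \<le> t k"
      using Mxy_ge(2)[where d = d and S = S and T = T] by (simp add: L_def t_def)
    let ?c = "\<lambda>k. L + e (p k) + d (x (p k)) u + d (x (Suc (p k))) u"
    have "t k \<le> ?c k" for k
      unfolding t_def
    proof (rule Mxy_le[where a = a and b = "x (Suc (p k))"])
      have "d (x (p k)) a \<le> d (x (p k)) u + L"
        using triangle[OF orbit_in uX aX, of "p k"] L_upper[OF a] by linarith
      then show "d u (x (Suc (p k))) + d (x (p k)) a \<le> 2 * ?c k"
        using L0 e_nonneg[of "p k"] nonneg[of "x (p k)" u] nonneg[of "x (Suc (p k))" u]
          commute[of u "x (Suc (p k))"] unfolding distrib_left by linarith
    next
      show "delta d {x (p k)} (T (x (p k))) \<le> ?c k"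
        using L0 p_alt[of k] by (simp add: e_def)
    qed (use L0 e_nonneg a next_T in \<open>simp_all add: commute flip: L_def\<close>)
    then show "\<forall>\<^sub>F k in sequentially. t k \<le> ?c k"
      by simp
    show "?c \<longlonglongrightarrow> L"
      using tendsto_add[OF tendsto_add[OF tendsto_add[OF tendsto_const dist_p(3)] dist_p(1)] dist_p(2)]
      by simp
  qed
  moreover have "s \<longlonglongrightarrow> L"
    using tendsto_max[OF tendsto_const tendsto_diff[OF tendsto_const dist_p(2)], of 0 L] L0
    by (simp add: s_def[abs_def] max_absorb2)
  moreover have "\<psi> (s k) \<le> \<psi> (t k) - \<phi> (t k)" for k
  proof -
    let ?\<delta> = "delta d (S u) (T (x (p k)))"
    have a_le: "d b (x (Suc (p k))) \<le> ?\<delta>" if "b \<in> S u" for b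
      using values_bounded uX orbit_in next_T that by (intro dist_le_delta) auto
    have "L \<le> ?\<delta> + d (x (Suc (p k))) u"
      unfolding L_def
    proof (rule delta_le)
      fix v b assume "v \<in> {u}" "b \<in> S u"
      moreover have "b \<in> X"
        using \<open>b \<in> S u\<close> values_bounded(1)[OF uX] mbounded_subset_mspace by blast
      ultimately show "d v b \<le> ?\<delta> + d (x (Suc (p k))) u"
        using a_le[of b] triangle[of u "x (Suc (p k))" b] uX orbit_in[of "Suc (p k)"]
        by (simp add: commute)
    qed (use values_bounded[OF uX] in auto)
    moreover have "0 \<le> ?\<delta>"
      using a_le[OF a] nonneg[of a "x (Suc (p k))"] by linarith
    ultimately have "s k \<le> ?\<delta>"
      by (simp add: s_def)
    then have "\<psi> (s k) \<le> \<psi> ?\<delta>"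
      by (intro psi_mono) (auto simp: s_def)
    also have "\<dots> \<le> \<psi> (t k) - \<phi> (t k)"
      unfolding t_def using contraction uX orbit_in below by blast
    finally show ?thesis .
  qed
  ultimately have "L = 0"
    using common_limit_zero[of s t L] by (auto simp: s_def t_def Mxy_nonneg)
  then have Su: "S u = {u}"
    using eq_singleton_if_delta_nonpos[OF uX] values_bounded[OF uX] by (simp add: L_def)
  define L' where "L' = delta d {u} (T u)"
  have L'_upper: "d u b \<le> L'" if "b \<in> T u" for b
    unfolding L'_def by (rule dist_le_delta_singleton[OF uX values_bounded(2)[OF uX] that])
  obtain b where b: "b \<in> T u"
    using values_bounded[OF uX] by blast
  have L'0: "0 \<le> L'"
    using L'_upper[OF b] nonneg[of u b] by linarith
  have "Mxy d S T u u \<le> L'"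
    by (rule Mxy_le[where a = u and b = b])
      (use L'0 L'_upper[OF b] uX Su b in \<open>auto simp: delta_singletons simp flip: L'_def\<close>)
  then have "Mxy d S T u u = L'"
    using Mxy_ge(3)[of d u T S u] by (simp add: L'_def)
  then have "\<psi> L' \<le> \<psi> L' - \<phi> L'"
    using contraction[of u u] order_refl uX Su by (auto simp: L'_def)
  then have "L' = 0"
    using no_increase[of L' L'] L'0 by simp
  then have "T u = {u}"
    using eq_singleton_if_delta_nonpos[OF uX] values_bounded[OF uX] by (simp add: L'_def)
  then show ?thesis
    using uX Su by blast
qed

end

section \<open>Common end points\<close>

theorem theorem2:
  fixes X :: "'a set" and d :: "'a \<Rightarrow> 'a \<Rightarrow> real" and r :: "('a \<times> 'a) set"
    and S T :: "'a \<Rightarrow> 'a set" and \<psi> \<phi> :: "real \<Rightarrow> real"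
  assumes "complete_ordered_Lup_metric_space X d r"
    and "T \<in> X \<rightarrow> bounded_subsets X d"
    and "S \<in> X \<rightarrow> bounded_subsets X d"
    and "partially_dominating X r T"
    and "partially_dominating X r S"
    and "\<psi> \<in> Upsilon"
    and "\<phi> \<in> {0..} \<rightarrow> {0..}"
    and "\<And>t :: nat \<Rightarrow> real. (\<And>n. 0 \<le> t n) \<Longrightarrow> (\<lambda>n. \<phi> (t n)) \<longlonglongrightarrow> 0 \<Longrightarrow> t \<longlonglongrightarrow> 0"
    and "gen_weak_contractive X d r \<psi> \<phi> S T"
  shows "(\<exists>u\<in>X. {u} = T u \<and> T u = S u) \<and>
         (end_points_comparable X r S T \<longrightarrow> (\<exists>!u. end_point X S u \<and> end_point X T u))"
proof -
  interpret complete_ordered_Lup_metric_space X d r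
    by (rule assms(1))
  interpret weak_contractive_pair X d r \<psi> \<phi> S T
    by unfold_locales (use assms in auto)
  obtain x where x: "x 0 \<in> X"
      "\<And>n. x (Suc n) \<in> alternating n (x n)" "\<And>n. (x n, x (Suc n)) \<in> r"
    using ex_increasing_orbit by blast
  interpret increasing_orbit X d r \<psi> \<phi> S T x
    by unfold_locales (use x in auto)
  obtain u where u: "u \<in> X" "S u = {u}" "T u = {u}"
    using common_end_point by blast
  have "\<exists>!u. end_point X S u \<and> end_point X T u" if "end_points_comparable X r S T"
    using u that comparable_common_end_points_eq
    by (intro ex1I[of _ u]) (auto simp: end_point_def end_points_comparable_def)
  then show ?thesis
    using u by auto
qed

end
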